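(* Let $X$ be a real Hilbert space, let $A,B:X\rightrightarrows X$ be maximally monotone with $Z=(A+B)^{-1}(0)\neq\varnothing$, let $T=\operatorname{Id}-J_A+J_BR_A$ with $\operatorname{Fix}T\neq\varnothing$, and let $\mathcal S=\{(z,k)\in X\times X: k\in Az,\ -k\in Bz\}$. Let $x\in X$ and let $(z,k)\in\mathcal S$. Then the following hold: (i) For every $n\in\mathbb N$, $$\|(J_AT^{n+1}x,J_{A^{-1}}T^{n+1}x)-(z,k)\|^2=\|J_AT^{n+1}x-z\|^2+\|J_{A^{-1}}T^{n+1}x-k\|^2\le\|J_AT^nx-z\|^2+\|J_{A^{-1}}T^nx-k\|^2=\|(J_AT^nx,J_{A^{-1}}T^nx)-(z,k)\|^2.$$ (ii) The sequence $(J_AT^nx,J_{A^{-1}}T^nx)_{n\in\mathbb N}$ is Fejér monotone with respect to $\mathcal S$. (iii) The sequence $(J_AT^nx,J_{A^{-1}}T^nx)_{n\in\mathbb N}$ converges weakly to some point in $\mathcal S$.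
   Context: For a maximally monotone operator $C:X\rightrightarrows X$, $J_C=(\operatorname{Id}+C)^{-1}$ is its resolvent and $R_C=2J_C-\operatorname{Id}$ its reflected resolvent; $C^{-1}$ is the set-valued inverse. $T$ is the Douglas--Rachford operator associated with $(A,B)$. $X\times X$ carries the product Hilbert space structure, $\|(a,b)\|^2=\|a\|^2+\|b\|^2$. A sequence $(x_n)_{n\in\mathbb N}$ is Fejér monotone with respect to a set $E$ if $\|x_{n+1}-e\|\le\|x_n-e\|$ for all $e\in E$ and all $n\in\mathbb N$. *)

theory Defs
  imports "HOL-Analysis.Analysis" "HOL-Library.Set_Algebras"
begin

text \<open>
  A set-valued operator on \<open>X\<close> is a function \<open>'a \<Rightarrow> 'a set\<close>. The sort
  \<open>{real_inner, complete_space}\<close> is that of real Hilbert spaces, and sums of sets are the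
  Minkowski sums of Set_Algebras.
\<close>

definition op_graph :: "('a \<Rightarrow> 'a set) \<Rightarrow> ('a \<times> 'a) set" where
  "op_graph A = {(x, u). u \<in> A x}"

definition op_inverse :: "('a \<Rightarrow> 'a set) \<Rightarrow> 'a \<Rightarrow> 'a set" where
  "op_inverse A u = {x. u \<in> A x}"

definition op_plus :: "('a::plus \<Rightarrow> 'a set) \<Rightarrow> ('a \<Rightarrow> 'a set) \<Rightarrow> 'a \<Rightarrow> 'a set" where
  "op_plus A B x = A x + B x"

definition op_id :: "'a \<Rightarrow> 'a set" where
  "op_id x = {x}"

definition monotone_op :: "('a::real_inner \<Rightarrow> 'a set) \<Rightarrow> bool" where
  "monotone_op A \<longleftrightarrow>
     (\<forall>(x, u) \<in> op_graph A. \<forall>(y, v) \<in> op_graph A. (x - y) \<bullet> (u - v) \<ge> 0)"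

definition maximally_monotone :: "('a::real_inner \<Rightarrow> 'a set) \<Rightarrow> bool" where
  "maximally_monotone A \<longleftrightarrow>
     monotone_op A \<and> (\<forall>B. monotone_op B \<and> op_graph A \<subseteq> op_graph B \<longrightarrow> op_graph B = op_graph A)"

text \<open>
  For a maximally monotone operator on a Hilbert space every value of the set-valued map
  \<open>(Id + C)\<^sup>-\<^sup>1\<close> is a singleton (Minty), and the resolvent is identified with the
  corresponding point-valued map. For other operators \<open>resolvent C x\<close> is unspecified where
  that value is not a singleton.
\<close>

definition resolvent :: "('a::real_inner \<Rightarrow> 'a set) \<Rightarrow> 'a \<Rightarrow> 'a" where
  "resolvent C x = the_elem (op_inverse (op_plus op_id C) x)"

definition reflected_resolvent :: "('a::real_inner \<Rightarrow> 'a set) \<Rightarrow> 'a \<Rightarrow> 'a" where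
  "reflected_resolvent C x = 2 *\<^sub>R resolvent C x - x"

definition douglas_rachford ::
    "('a::real_inner \<Rightarrow> 'a set) \<Rightarrow> ('a \<Rightarrow> 'a set) \<Rightarrow> 'a \<Rightarrow> 'a" where
  "douglas_rachford A B x = x - resolvent A x + resolvent B (reflected_resolvent A x)"

definition fix_points :: "('a \<Rightarrow> 'a) \<Rightarrow> 'a set" where
  "fix_points T = {x. T x = x}"

definition primal_solutions :: "('a::real_inner \<Rightarrow> 'a set) \<Rightarrow> ('a \<Rightarrow> 'a set) \<Rightarrow> 'a set" where
  "primal_solutions A B = op_inverse (op_plus A B) 0"

definition extended_solutions ::
    "('a::real_inner \<Rightarrow> 'a set) \<Rightarrow> ('a \<Rightarrow> 'a set) \<Rightarrow> ('a \<times> 'a) set" where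
  "extended_solutions A B = {(z, k). k \<in> A z \<and> - k \<in> B z}"

definition fejer_monotone :: "(nat \<Rightarrow> 'a::real_normed_vector) \<Rightarrow> 'a set \<Rightarrow> bool" where
  "fejer_monotone x E \<longleftrightarrow> (\<forall>e\<in>E. \<forall>n. norm (x (Suc n) - e) \<le> norm (x n - e))"

text \<open>
  Weak convergence of a sequence in a Hilbert space, whose continuous linear functionals are the
  maps \<open>\<lambda>x. x \<bullet> u\<close>.
\<close>

definition weakly_converges_to :: "(nat \<Rightarrow> 'a::real_inner) \<Rightarrow> 'a \<Rightarrow> bool" where
  "weakly_converges_to x l \<longleftrightarrow> (\<forall>u. (\<lambda>n. x n \<bullet> u) \<longlonglongrightarrow> l \<bullet> u)"

end

theory Submission
  imports Defs "HOL-Library.Diagonal_Subsequence"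
begin

text \<open>
  Write \<open>a = J\<^sub>A x\<close>, \<open>u = x - a\<close>, \<open>b = J\<^sub>B (a - u)\<close> and \<open>v = a - u - b\<close>, so that \<open>u \<in> A a\<close>,
  \<open>v \<in> B b\<close>, \<open>u = J x\<close> for the resolvent \<open>J\<close> of the inverse of \<open>A\<close>, and \<open>T x = u + b\<close>.
  Monotonicity of \<open>A\<close> at the next iterate and of \<open>B\<close> at \<open>b\<close> shows that one step decreases the
  squared distance of \<open>(a, u)\<close> to every extended solution by at least \<open>(norm (a - b))\<^sup>2\<close>. Hence the
  sequence is Fejer monotone and \<open>a - b = u + v\<close> tends to 0 along it, which forces weak cluster points
  to be extended solutions, and Opial's argument gives weak convergence.

  Single-valuedness of resolvents (Minty) and the Riesz representation theorem, from which weak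
  sequential compactness follows, are both instances of the minimization of \<open>r + (norm w)\<^sup>2 / 2\<close>
  over a closed convex set of pairs \<open>(w, r)\<close>.
\<close>

section \<open>Minty's theorem and the Riesz representation\<close>

text \<open>Strict convexity of the quadratic term makes the first components of a minimizing
  sequence Cauchy. Their values under \<open>h\<close> converge, so the second components converge
  too, and closedness puts the limit in \<open>C\<close>. The inequality obtained is the first-order
  optimality condition at this minimizer.\<close>

lemma regularized_minimum:
  fixes C :: "('b::{real_inner, complete_space} \<times> real) set"
  assumes "convex C" "closed C" "C \<noteq> {}"
    and bound: "\<And>w r. (w, r) \<in> C \<Longrightarrow> b \<le> r + (norm w)\<^sup>2 / 2"
  obtains w r where "(w, r) \<in> C" "\<And>w' r'. (w', r') \<in> C \<Longrightarrow> 0 \<le> r' - r + w \<bullet> (w' - w)"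
proof -
  define h :: "'b \<times> real \<Rightarrow> real" where "h c = snd c + (norm (fst c))\<^sup>2 / 2" for c
  define m where "m = Inf (h ` C)"
  define e where "e n = inverse (real (Suc n))" for n
  have "bdd_below (h ` C)"
    using bound by (force simp: h_def intro!: bdd_belowI[where m=b])
  then have m_le: "m \<le> h c" if "c \<in> C" for c
    using that by (simp add: m_def cInf_lower)
  have "\<exists>c\<in>C. h c < m + e n" for n
    using cInf_lessD[of "h ` C" "m + e n"] \<open>C \<noteq> {}\<close> by (auto simp: m_def e_def)
  then obtain c where cC: "\<And>n. c n \<in> C" and c_less: "\<And>n. h (c n) < m + e n"
    by metis
  define w where "w n = fst (c n)" for n
  \<comment> \<open>At the midpoint of \<open>c i\<close> and \<open>c j\<close> the value of
    \<open>h\<close> is below the mean of the two values by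
    \<open>(norm (w i - w j))\<^sup>2 / 8\<close>, yet still at least \<open>m\<close>. Both values
    exceed \<open>m\<close> by less than \<open>e i\<close> and \<open>e j\<close>, whence the
    factor 4.\<close>
  have dist_bound: "(norm (w i - w j))\<^sup>2 \<le> 4 * e i + 4 * e j" for i j
  proof -
    have "(1/2) *\<^sub>R c i + (1/2) *\<^sub>R c j \<in> C"
      using \<open>convex C\<close> cC by (simp add: convexD)
    then have "m \<le> h ((1/2) *\<^sub>R c i + (1/2) *\<^sub>R c j)" by (rule m_le)
    also have "\<dots> = h (c i) / 2 + h (c j) / 2 - (norm (w i - w j))\<^sup>2 / 8"
      by (simp add: h_def w_def power2_norm_eq_inner inner_simps inner_commute field_simps)
    finally show ?thesis using c_less[of i] c_less[of j] by (simp add: field_simps)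
  qed
  have "Cauchy w"
  proof (rule metric_CauchyI)
    fix d :: real assume "d > 0"
    then obtain M where M: "8 * e M < d\<^sup>2"
      using reals_Archimedean[of "d\<^sup>2 / 8"] by (auto simp: e_def field_simps)
    have "dist (w i) (w j) < d" if "M \<le> i" "M \<le> j" for i j
    proof -
      have "e i \<le> e M" "e j \<le> e M"
        using that by (simp_all add: e_def)
      then have "(norm (w i - w j))\<^sup>2 < d\<^sup>2"
        using dist_bound[of i j] M by linarith
      then show ?thesis
        using \<open>d > 0\<close> by (simp add: dist_norm power2_less_imp_less)
    qed
    then show "\<exists>M. \<forall>i\<ge>M. \<forall>j\<ge>M. dist (w i) (w j) < d" by blast
  qed
  then obtain p where p: "w \<longlonglongrightarrow> p"
    using Cauchy_convergent convergent_def by blast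
  have "(\<lambda>n. m + e n) \<longlonglongrightarrow> m + 0"
    unfolding e_def by (intro tendsto_intros LIMSEQ_inverse_real_of_nat)
  then have "(\<lambda>n. m + e n) \<longlonglongrightarrow> m" by simp
  then have "(\<lambda>n. h (c n)) \<longlonglongrightarrow> m"
    by (rule tendsto_sandwich[OF always_eventually always_eventually tendsto_const, rotated 2])
      (use less_imp_le[OF c_less] m_le[OF cC] in auto)
  then have "(\<lambda>n. h (c n) - (norm (w n))\<^sup>2 / 2) \<longlonglongrightarrow> m - (norm p)\<^sup>2 / 2"
    by (intro tendsto_intros p) auto
  then have "(\<lambda>n. snd (c n)) \<longlonglongrightarrow> m - (norm p)\<^sup>2 / 2"
    by (simp add: h_def w_def)
  with p have "(\<lambda>n. (fst (c n), snd (c n))) \<longlonglongrightarrow> (p, m - (norm p)\<^sup>2 / 2)"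
    unfolding w_def by (rule tendsto_Pair)
  then have pC: "(p, m - (norm p)\<^sup>2 / 2) \<in> C"
    using \<open>closed C\<close> cC by (auto intro: closed_sequentially)
  define r where "r = m - (norm p)\<^sup>2 / 2"
  show ?thesis
  proof (rule that)
    show "(p, r) \<in> C" using pC by (simp add: r_def)
    fix w' r' assume w': "(w', r') \<in> C"
    define d where "d = r' - r + p \<bullet> (w' - p)"
    \<comment> \<open>The minimizer is compared with the point at parameter \<open>t\<close> on the
      segment towards \<open>(w', r')\<close>, and the difference is divided by \<open>t\<close>.
      Letting \<open>t\<close> decrease to 0 then leaves \<open>0 \<le> d\<close>.\<close>
    have ineq: "0 \<le> d + t * (norm (w' - p))\<^sup>2 / 2" if "0 < t" "t \<le> 1" for t
    proof -
      have "(1 - t) *\<^sub>R (p, r) + t *\<^sub>R (w', r') \<in> C"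
        using \<open>convex C\<close> w' pC that unfolding r_def by (intro convexD) auto
      then have "m \<le> (1 - t) * r + t * r' + (norm ((1 - t) *\<^sub>R p + t *\<^sub>R w'))\<^sup>2 / 2"
        using m_le by (fastforce simp: h_def)
      also have "(norm ((1 - t) *\<^sub>R p + t *\<^sub>R w'))\<^sup>2
          = (norm p)\<^sup>2 + 2 * t * (p \<bullet> (w' - p)) + t\<^sup>2 * (norm (w' - p))\<^sup>2"
        by (simp add: power2_norm_eq_inner inner_simps inner_commute power2_eq_square[of t] algebra_simps)
      finally have "0 \<le> t * (d + t * (norm (w' - p))\<^sup>2 / 2)"
        by (simp add: r_def d_def power2_norm_eq_inner inner_simps inner_commute power2_eq_square[of t]
            algebra_simps add_divide_distrib diff_divide_distrib)
      then show ?thesis using that by (simp add: zero_le_mult_iff)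
    qed
    have "((\<lambda>t. d + t * (norm (w' - p))\<^sup>2 / 2) \<longlongrightarrow> d + 0 * (norm (w' - p))\<^sup>2 / 2) (at_right 0)"
      by (intro tendsto_intros) simp_all
    moreover have "\<forall>\<^sub>F t in at_right 0. 0 \<le> d + t * (norm (w' - p))\<^sup>2 / 2"
      using ineq by (auto simp: eventually_at_right_field intro!: exI[of _ 1])
    ultimately show "0 \<le> r' - r + p \<bullet> (w' - p)"
      using tendsto_lowerbound unfolding d_def[symmetric] by fastforce
  qed
qed

text \<open>Adding the pair \<open>(x, u)\<close> to the graph keeps it monotone, so by maximality
  the pair was already there.\<close>

lemma maximally_monotone_memI:
  assumes "maximally_monotone A" and rel: "\<And>y v. v \<in> A y \<Longrightarrow> 0 \<le> (x - y) \<bullet> (u - v)"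
  shows "u \<in> A x"
proof -
  define B where "B = A(x := insert u (A x))"
  have mono: "0 \<le> (y - y') \<bullet> (v - v')" if "v \<in> A y" "v' \<in> A y'" for y y' v v'
    using assms(1) that unfolding maximally_monotone_def monotone_op_def op_graph_def by auto
  have rel': "0 \<le> (y - x) \<bullet> (v - u)" if "v \<in> A y" for y v
    using rel[OF that] by (simp add: inner_diff_left inner_diff_right)
  have "monotone_op B"
    using mono rel rel'
    by (auto simp: monotone_op_def op_graph_def B_def split: if_splits)
  moreover have "op_graph A \<subseteq> op_graph B" by (auto simp: op_graph_def B_def)
  ultimately have "op_graph B = op_graph A"
    using assms(1) unfolding maximally_monotone_def by blast
  then show ?thesis by (auto simp: op_graph_def B_def)
qed

lemma maximally_monotoneD:
  assumes "maximally_monotone A" "u \<in> A x" "v \<in> A y"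
  shows "0 \<le> (x - y) \<bullet> (u - v)"
  using assms unfolding maximally_monotone_def monotone_op_def op_graph_def by auto

lemma minty:
  fixes A :: "'a::{real_inner, complete_space} \<Rightarrow> 'a set"
  assumes A: "maximally_monotone A"
  shows "\<exists>a. x - a \<in> A a"
proof -
  \<comment> \<open>The epigraph of the Fitzpatrick function of \<open>y \<mapsto> A y - x\<close>; by maximality this function
    dominates \<open>(p, q) \<mapsto> p \<bullet> q\<close>, so that adding \<open>(norm (p, q))\<^sup>2 / 2\<close> makes it nonnegative.\<close>
  define C where "C = {((p, q), r). \<forall>y v. v \<in> A y \<longrightarrow> p \<bullet> (v - x) + y \<bullet> q - y \<bullet> (v - x) \<le> r}"
  have in_C: "((y, v - x), y \<bullet> (v - x)) \<in> C" if "v \<in> A y" for y v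
    using maximally_monotoneD[OF A that] by (fastforce simp: C_def inner_diff_left inner_diff_right)
  have C_ge: "p \<bullet> q \<le> r" if "((p, q), r) \<in> C" for p q r
  proof (rule ccontr)
    assume "\<not> p \<bullet> q \<le> r"
    \<comment> \<open>If \<open>r < p \<bullet> q\<close>, the inequalities defining
      \<open>C\<close> make \<open>(p, q + x)\<close> monotonically related to the graph of
      \<open>A\<close>. Once this pair is in the graph, its own inequality reads
      \<open>p \<bullet> q \<le> r\<close>, a contradiction.\<close>
    have "q + x \<in> A p"
    proof (rule maximally_monotone_memI[OF A])
      fix y v assume "v \<in> A y"
      then have "p \<bullet> (v - x) + y \<bullet> q - y \<bullet> (v - x) \<le> r" using that by (simp add: C_def)
      then show "0 \<le> (p - y) \<bullet> (q + x - v)"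
        using \<open>\<not> p \<bullet> q \<le> r\<close> by (simp add: inner_simps)
    qed
    then show False using that \<open>\<not> p \<bullet> q \<le> r\<close> by (fastforce simp: C_def)
  qed
  have "C = (\<Inter>(y, v)\<in>{(y, v). v \<in> A y}. {c. fst (fst c) \<bullet> (v - x) + y \<bullet> snd (fst c) - y \<bullet> (v - x) \<le> snd c})"
    by (auto simp: C_def)
  also have "closed \<dots>"
    by (auto intro!: closed_INT closed_Collect_le continuous_intros)
  finally have "closed C" .
  have "convex C"
    unfolding convex_def
  proof (clarsimp simp: C_def)
    fix p q r p' q' r' s t y v
    assume *: "\<forall>y v. v \<in> A y \<longrightarrow> p \<bullet> (v - x) + y \<bullet> q - y \<bullet> (v - x) \<le> r"
      "\<forall>y v. v \<in> A y \<longrightarrow> p' \<bullet> (v - x) + y \<bullet> q' - y \<bullet> (v - x) \<le> r'"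
      "0 \<le> s" "0 \<le> t" "s + t = (1::real)" "v \<in> A y"
    then have "s * (p \<bullet> (v - x) + y \<bullet> q - y \<bullet> (v - x)) + t * (p' \<bullet> (v - x) + y \<bullet> q' - y \<bullet> (v - x)) \<le> s * r + t * r'"
      by (intro add_mono mult_left_mono) auto
    moreover have "y \<bullet> (v - x) = s * (y \<bullet> (v - x)) + t * (y \<bullet> (v - x))"
      using \<open>s + t = 1\<close> by (metis distrib_right mult_1)
    ultimately show "(s *\<^sub>R p + t *\<^sub>R p') \<bullet> (v - x) + y \<bullet> (s *\<^sub>R q + t *\<^sub>R q') - y \<bullet> (v - x) \<le> s * r + t * r'"
      by (simp add: inner_add_left inner_add_right algebra_simps)
  qed
  have "C \<noteq> {}"
  proof (cases "\<exists>y v. v \<in> A y")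
    case True
    then show ?thesis using in_C by blast
  next
    case False
    then show ?thesis by (auto simp: C_def)
  qed
  have "0 \<le> r + (norm w)\<^sup>2 / 2" if "(w, r) \<in> C" for w r
  proof -
    obtain p q where w: "w = (p, q)" by fastforce
    have "0 \<le> (norm (p + q))\<^sup>2 / 2" by simp
    also have "\<dots> \<le> r + (norm w)\<^sup>2 / 2"
      using C_ge[of p q r] that
      by (simp add: w power2_norm_eq_inner inner_simps inner_commute add_divide_distrib)
    finally show ?thesis .
  qed
  with \<open>convex C\<close> \<open>closed C\<close> \<open>C \<noteq> {}\<close> obtain w r where wr: "(w, r) \<in> C"
    and var: "\<And>w' r'. (w', r') \<in> C \<Longrightarrow> 0 \<le> r' - r + w \<bullet> (w' - w)"
    by (rule regularized_minimum) blast+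
  obtain p q where w: "w = (p, q)" by fastforce
  \<comment> \<open>The optimality condition is tested at the point of \<open>C\<close> that comes
    from the graph pair \<open>(y, v)\<close>, and \<open>r\<close> is replaced by its lower bound
    \<open>p \<bullet> q\<close>.\<close>
  have key: "(norm (p + q))\<^sup>2 \<le> (- q - y) \<bullet> (x - p - v)" if "v \<in> A y" for y v
    using var[OF in_C[OF that]] C_ge[of p q r] wr
    by (simp add: w power2_norm_eq_inner inner_simps inner_commute)
  \<comment> \<open>By \<open>key\<close> the pair \<open>(- q, x - p)\<close> is monotonically
    related to \<open>A\<close>. Inserting this pair itself into \<open>key\<close> makes the right
    side 0, so that \<open>p = - q\<close>.\<close>
  have mem: "x - p \<in> A (- q)"
    by (rule maximally_monotone_memI[OF A]) (use key in \<open>force intro: order_trans[OF zero_le_power2]\<close>)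
  from key[OF this] have "- q = p" by (simp add: add_eq_0_iff2)
  with mem show ?thesis by metis
qed

text \<open>The representing vector minimizes \<open>(norm y)\<^sup>2 / 2 - \<phi> y\<close> over
  \<open>V\<close>, so \<open>C\<close> is the graph of \<open>- \<phi>\<close> on \<open>V\<close>.
  Working on a closed subspace also yields orthogonal projections: for
  \<open>\<phi> = (\<bullet>) y\<close> the vector found is the projection of \<open>y\<close> onto
  \<open>V\<close>.\<close>

lemma Riesz_representation_subspace:
  fixes V :: "'b::{real_inner, complete_space} set"
  assumes V: "subspace V" "closed V"
    and add: "\<And>x y. x \<in> V \<Longrightarrow> y \<in> V \<Longrightarrow> \<phi> (x + y) = \<phi> x + \<phi> y"
    and scale: "\<And>c x. x \<in> V \<Longrightarrow> \<phi> (c *\<^sub>R x) = c * \<phi> x"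
    and bound: "\<And>x. x \<in> V \<Longrightarrow> \<bar>\<phi> x\<bar> \<le> K * norm x"
  obtains l where "l \<in> V" "\<And>y. y \<in> V \<Longrightarrow> \<phi> y = l \<bullet> y"
proof -
  have diff: "\<phi> (x - y) = \<phi> x - \<phi> y" if "x \<in> V" "y \<in> V" for x y
    using add[of x "(-1) *\<^sub>R y"] scale[of y "-1"] that subspace_scale[OF V(1), of y "-1"] by simp
  define C where "C = (\<lambda>y. (y, - \<phi> y)) ` V"
  have "convex C"
    unfolding convex_def C_def using V(1)
    by (auto simp: image_iff add scale subspace_scale subspace_add)
  moreover have "closed C"
    unfolding closed_sequential_limits
  proof (intro allI impI, elim conjE)
    fix c and l :: "'b \<times> real"
    assume c: "\<forall>n. c n \<in> C" and lim: "c \<longlonglongrightarrow> l"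
    have fst: "(\<lambda>n. fst (c n)) \<longlonglongrightarrow> fst l" and snd: "(\<lambda>n. snd (c n)) \<longlonglongrightarrow> snd l"
      using lim by (auto intro: tendsto_fst tendsto_snd)
    have cV: "fst (c n) \<in> V" "snd (c n) = - \<phi> (fst (c n))" for n
      using c by (auto simp: C_def) (metis (mono_tags) fst_conv image_iff snd_conv)+
    have lV: "fst l \<in> V" by (rule closed_sequentially[OF V(2) cV(1) fst])
    have "\<forall>n. norm (snd (c n) - - \<phi> (fst l)) \<le> K * norm (fst (c n) - fst l)"
    proof
      fix n
      show "norm (snd (c n) - - \<phi> (fst l)) \<le> K * norm (fst (c n) - fst l)"
        using bound[OF subspace_diff[OF V(1) cV(1)[of n] lV]] diff[OF cV(1)[of n] lV] cV(2)[of n]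
        by (simp only: real_norm_def)
    qed
    moreover have "(\<lambda>n. K * norm (fst (c n) - fst l)) \<longlonglongrightarrow> 0"
      using tendsto_mult_right_zero[OF tendsto_norm_zero[OF LIM_zero[OF fst]]] by simp
    ultimately have "(\<lambda>n. snd (c n) - - \<phi> (fst l)) \<longlonglongrightarrow> 0"
      by (rule Lim_null_comparison[OF always_eventually])
    then have "snd l = - \<phi> (fst l)"
      by (rule LIMSEQ_unique[OF snd LIM_zero_cancel])
    then show "l \<in> C" using lV by (force simp: C_def image_iff prod_eq_iff)
  qed
  moreover have "C \<noteq> {}" using subspace_0[OF V(1)] by (auto simp: C_def)
  \<comment> \<open>The lower bound comes from completing the square in
    \<open>- K * norm w + (norm w)\<^sup>2 / 2\<close>.\<close>
  moreover have "- K\<^sup>2 / 2 \<le> r + (norm w)\<^sup>2 / 2" if "(w, r) \<in> C" for w r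
  proof -
    have "- r \<le> K * norm w" using that bound[of w] by (auto simp: C_def)
    moreover have "0 \<le> (K - norm w)\<^sup>2" by simp
    ultimately show ?thesis by (simp add: power2_diff)
  qed
  ultimately obtain l r where lr: "(l, r) \<in> C"
    and var: "\<And>w' r'. (w', r') \<in> C \<Longrightarrow> 0 \<le> r' - r + l \<bullet> (w' - l)"
    by (rule regularized_minimum) blast+
  have l: "l \<in> V" "r = - \<phi> l" using lr by (auto simp: C_def)
  \<comment> \<open>Since \<open>V\<close> is a subspace, this can be used for both \<open>d\<close>
    and \<open>- d\<close>, which turns the inequality into an equality.\<close>
  have var': "0 \<le> - \<phi> d + l \<bullet> d" if "d \<in> V" for d
  proof -
    have "(l + d, - \<phi> (l + d)) \<in> C"
      using subspace_add[OF V(1) l(1) that] by (simp add: C_def)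
    from var[OF this] show ?thesis using l that by (simp add: add)
  qed
  show ?thesis
  proof (rule that)
    fix y assume "y \<in> V"
    then show "\<phi> y = l \<bullet> y"
      using var'[of y] var'[of "- y"] diff[of 0 y] diff[of 0 0] V(1)
      by (simp add: subspace_0 subspace_neg)
  qed (rule l)
qed

section \<open>Weak convergence of Fejer monotone sequences\<close>

text \<open>A diagonal subsequence converges when tested against every \<open>w m\<close>. The test
  vectors for which it converges form a closed subspace, which turns out to be the whole space, and
  the Riesz representation of the limit functional supplies \<open>l\<close>.\<close>

lemma bounded_weakly_convergent_subsequence:
  fixes w :: "nat \<Rightarrow> 'b::{real_inner, complete_space}"
  assumes bound: "\<And>n. norm (w n) \<le> K"
  obtains s l where "strict_mono s" "weakly_converges_to (w \<circ> s) l"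
proof -
  define P where "P m s \<longleftrightarrow> convergent (\<lambda>j. w (s j) \<bullet> w m)" for m and s :: "nat \<Rightarrow> nat"
  have inner_bound: "\<bar>w n \<bullet> y\<bar> \<le> K * norm y" for n y
    using Cauchy_Schwarz_ineq2[of "w n" y] mult_right_mono[OF bound[of n] norm_ge_zero[of y]] by linarith
  interpret subseqs P
  proof
    fix n and s :: "nat \<Rightarrow> nat"
    have bd: "bounded (range (\<lambda>j. w (s j) \<bullet> w n))"
      using inner_bound by (intro boundedI[where B = "K * norm (w n)"]) auto
    obtain l r where "strict_mono r" "((\<lambda>j. w (s j) \<bullet> w n) \<circ> r) \<longlonglongrightarrow> l"
      using bounded_imp_convergent_subsequence[OF bd] by blast
    then have "strict_mono r \<and> P n (s \<circ> r)"
      by (auto simp: P_def o_def convergent_def)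
    then show "\<exists>r'. strict_mono r' \<and> P n (s \<circ> r')" by blast
  qed
  define s where "s = diagseq"
  have s: "strict_mono s" unfolding s_def by (rule subseq_diagseq)
  have conv_w: "convergent (\<lambda>j. w (s j) \<bullet> w m)" for m
  proof -
    \<comment> \<open>From index \<open>Suc m\<close> on, the diagonal sequence is a subsequence of
      the stage at which \<open>P m\<close> was arranged, and \<open>P m\<close> passes to
      subsequences.\<close>
    have "P m (diagseq \<circ> (+) (Suc m))"
    proof (rule diagseq_holds)
      fix r s :: "nat \<Rightarrow> nat" and n assume "strict_mono r" "P n s"
      then show "P n (s \<circ> r)"
        using convergent_subseq_convergent[of "\<lambda>j. w (s j) \<bullet> w n" r] by (simp add: P_def o_def)
    qed
    then show ?thesis
      using convergent_ignore_initial_segment[of "\<lambda>j. w (s j) \<bullet> w m" "Suc m"]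
      by (simp add: P_def s_def o_def add.commute)
  qed
  define V where "V = {y. convergent (\<lambda>j. w (s j) \<bullet> y)}"
  define \<phi> where "\<phi> y = lim (\<lambda>j. w (s j) \<bullet> y)" for y
  have lim: "(\<lambda>j. w (s j) \<bullet> y) \<longlonglongrightarrow> \<phi> y" if "y \<in> V" for y
    using that by (simp add: V_def \<phi>_def convergent_LIMSEQ_iff)
  have "subspace V"
    by (auto simp: subspace_def V_def inner_add_right intro!: convergent_add convergent_mult convergent_const)
  have "closed V"
    unfolding closed_sequential_limits
  proof (intro allI impI, elim conjE)
    fix y l assume y: "\<forall>n. y n \<in> V" "y \<longlonglongrightarrow> l"
    \<comment> \<open>An argument with three thirds of \<open>e\<close>: replacing \<open>l\<close>
      by a close \<open>y n\<close> changes every term by less than \<open>e / 3\<close>, uniformly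
      in \<open>j\<close>, since the sequence is bounded by \<open>K\<close>.\<close>
    have "Cauchy (\<lambda>j. w (s j) \<bullet> l)"
    proof (rule metric_CauchyI)
      fix e :: real assume "e > 0"
      have "(\<lambda>n. K * norm (l - y n)) \<longlonglongrightarrow> K * norm (l - l)"
        by (intro tendsto_intros y)
      then have "\<forall>\<^sub>F n in sequentially. K * norm (l - y n) < e / 3"
        using \<open>e > 0\<close> by (intro order_tendstoD) auto
      then obtain n where n: "K * norm (l - y n) < e / 3"
        by (auto simp: eventually_sequentially)
      have "Cauchy (\<lambda>j. w (s j) \<bullet> y n)"
        using y(1) by (simp add: V_def convergent_Cauchy)
      then obtain M where M: "\<And>i j. i \<ge> M \<Longrightarrow> j \<ge> M \<Longrightarrow> dist (w (s i) \<bullet> y n) (w (s j) \<bullet> y n) < e / 3"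
        using metric_CauchyD[of _ "e / 3"] \<open>e > 0\<close> by (metis divide_pos_pos zero_less_numeral)
      have "dist (w (s i) \<bullet> l) (w (s j) \<bullet> l) < e" if "i \<ge> M" "j \<ge> M" for i j
        using M[OF that] n inner_bound[of "s i" "l - y n"] inner_bound[of "s j" "l - y n"]
        unfolding dist_real_def inner_diff_right by linarith
      then show "\<exists>M. \<forall>i\<ge>M. \<forall>j\<ge>M. dist (w (s i) \<bullet> l) (w (s j) \<bullet> l) < e" by blast
    qed
    then show "l \<in> V" by (simp add: V_def Cauchy_convergent)
  qed
  \<comment> \<open>Every \<open>w m\<close> lies in \<open>V\<close>, so the component of \<open>y\<close> orthogonal to \<open>V\<close> is invisible to the sequence.\<close>
  have "y \<in> V" for y
  proof -
    obtain p where p: "p \<in> V" "\<And>v. v \<in> V \<Longrightarrow> y \<bullet> v = p \<bullet> v"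
      by (rule Riesz_representation_subspace[OF \<open>subspace V\<close> \<open>closed V\<close>, of "(\<bullet>) y" "norm y"])
        (auto simp: inner_add_right Cauchy_Schwarz_ineq2)
    have "w m \<in> V" for m by (simp add: V_def conv_w)
    from p(2)[OF this] have "w (s j) \<bullet> y = w (s j) \<bullet> p" for j by (simp add: inner_commute)
    then show ?thesis using p(1) by (simp add: V_def)
  qed
  then have V: "V = UNIV" by blast
  obtain l where l: "\<And>y. \<phi> y = l \<bullet> y"
  proof (rule Riesz_representation_subspace[OF \<open>subspace V\<close> \<open>closed V\<close>, of \<phi> K])
    fix x y c
    show "\<phi> (x + y) = \<phi> x + \<phi> y"
      using LIMSEQ_unique[OF lim, of "x + y" "\<phi> x + \<phi> y"] tendsto_add[OF lim lim, of x y] V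
      by (simp add: inner_add_right)
    show "\<phi> (c *\<^sub>R x) = c * \<phi> x"
      using LIMSEQ_unique[OF lim, of "c *\<^sub>R x" "c * \<phi> x"] tendsto_mult_left[OF lim, of x c] V by simp
    show "\<bar>\<phi> x\<bar> \<le> K * norm x"
      using inner_bound V by (intro LIMSEQ_le_const2[OF tendsto_rabs[OF lim]]) auto
  qed (auto simp: V)
  show ?thesis
    using that[OF s, of l] lim V l by (auto simp: weakly_converges_to_def)
qed

lemma not_tendsto_subsequence:
  fixes f :: "nat \<Rightarrow> 'b::metric_space"
  assumes "\<not> f \<longlonglongrightarrow> l"
  shows "\<exists>e>0. \<exists>r :: nat \<Rightarrow> nat. strict_mono r \<and> (\<forall>n. e \<le> dist (f (r n)) l)"
proof -
  obtain e where e: "e > 0" "\<exists>\<^sub>F n in sequentially. e \<le> dist (f n) l"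
    using assms by (auto simp: tendsto_iff frequently_def not_le)
  then have "infinite {n. e \<le> dist (f n) l}"
    by (simp add: frequently_cofinite[symmetric] cofinite_eq_sequentially)
  then have "strict_mono (enumerate {n. e \<le> dist (f n) l})" "\<forall>n. e \<le> dist (f (enumerate {n. e \<le> dist (f n) l} n)) l"
    using strict_mono_enumerate enumerate_in_set by blast+
  with e(1) show ?thesis by blast
qed

text \<open>Fejer monotonicity gives boundedness, hence a weak cluster point, and also convergent
  distances to the points of \<open>E\<close>, which leave room for only one cluster point.\<close>

lemma fejer_monotone_weak_convergence:
  fixes w :: "nat \<Rightarrow> 'b::{real_inner, complete_space}"
  assumes fejer: "fejer_monotone w E" and "E \<noteq> {}"
    and cluster: "\<And>r l. strict_mono r \<Longrightarrow> weakly_converges_to (w \<circ> r) l \<Longrightarrow> l \<in> E"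
  shows "\<exists>l\<in>E. weakly_converges_to w l"
proof -
  have dec: "decseq (\<lambda>n. norm (w n - e))" if "e \<in> E" for e
    using fejer that by (auto simp: fejer_monotone_def intro: decseq_SucI)
  obtain e where "e \<in> E" using \<open>E \<noteq> {}\<close> by blast
  have bound: "norm (w n) \<le> norm (w 0 - e) + norm e" for n
    using decseqD[OF dec[OF \<open>e \<in> E\<close>], of 0 n] norm_triangle_ineq[of "w n - e" e] by simp
  obtain s l where s: "strict_mono s" and l: "weakly_converges_to (w \<circ> s) l"
    by (rule bounded_weakly_convergent_subsequence[OF bound])
  have "l \<in> E" using cluster s l .
  \<comment> \<open>Opial's argument: \<open>norm (w n - l)\<close> and \<open>norm (w n - l')\<close> both converge, hence so does \<open>w n \<bullet> (l - l')\<close>,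
    and its limits along the two subsequences agree.\<close>
  have unique: "l' = l" if r: "strict_mono r" "weakly_converges_to (w \<circ> r) l'" for r l'
  proof -
    have "l' \<in> E" using cluster r .
    have norm_conv: "convergent (\<lambda>n. norm (w n - e))" if "e \<in> E" for e
      using decseq_convergent[OF dec[OF that], of 0] by (auto simp: convergent_def)
    have "convergent (\<lambda>n. ((norm (w n - l'))\<^sup>2 - (norm (w n - l))\<^sup>2 + (norm l)\<^sup>2 - (norm l')\<^sup>2) / 2)"
    proof -
      obtain a b where "(\<lambda>n. norm (w n - l)) \<longlonglongrightarrow> a" "(\<lambda>n. norm (w n - l')) \<longlonglongrightarrow> b"
        using norm_conv[OF \<open>l \<in> E\<close>] norm_conv[OF \<open>l' \<in> E\<close>] by (auto simp: convergent_def)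
      then have "(\<lambda>n. ((norm (w n - l'))\<^sup>2 - (norm (w n - l))\<^sup>2 + (norm l)\<^sup>2 - (norm l')\<^sup>2) / 2)
          \<longlonglongrightarrow> (b\<^sup>2 - a\<^sup>2 + (norm l)\<^sup>2 - (norm l')\<^sup>2) / 2"
        by (intro tendsto_intros) auto
      then show ?thesis by (rule convergentI)
    qed
    moreover have "(\<lambda>n. ((norm (w n - l'))\<^sup>2 - (norm (w n - l))\<^sup>2 + (norm l)\<^sup>2 - (norm l')\<^sup>2) / 2)
        = (\<lambda>n. w n \<bullet> (l - l'))"
      by (simp add: power2_norm_eq_inner inner_simps inner_commute fun_eq_iff)
    ultimately obtain c where c: "(\<lambda>n. w n \<bullet> (l - l')) \<longlonglongrightarrow> c"
      by (auto simp: convergent_def)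
    have "c = l \<bullet> (l - l')"
    proof (rule LIMSEQ_unique)
      show "(\<lambda>n. w (s n) \<bullet> (l - l')) \<longlonglongrightarrow> c"
        using LIMSEQ_subseq_LIMSEQ[OF c s] by (simp add: o_def)
      show "(\<lambda>n. w (s n) \<bullet> (l - l')) \<longlonglongrightarrow> l \<bullet> (l - l')"
        using l by (simp add: weakly_converges_to_def)
    qed
    moreover have "c = l' \<bullet> (l - l')"
    proof (rule LIMSEQ_unique)
      show "(\<lambda>n. w (r n) \<bullet> (l - l')) \<longlonglongrightarrow> c"
        using LIMSEQ_subseq_LIMSEQ[OF c r(1)] by (simp add: o_def)
      show "(\<lambda>n. w (r n) \<bullet> (l - l')) \<longlonglongrightarrow> l' \<bullet> (l - l')"
        using r(2) by (simp add: weakly_converges_to_def)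
    qed
    ultimately have "(l - l') \<bullet> (l - l') = 0" by (simp add: inner_diff_left)
    then show ?thesis by simp
  qed
  \<comment> \<open>If testing against some \<open>u\<close> failed, a subsequence would stay at
    distance at least \<open>d\<close> from \<open>l \<bullet> u\<close>; but a further subsequence
    converges weakly, and by uniqueness its limit is \<open>l\<close>.\<close>
  have "weakly_converges_to w l"
    unfolding weakly_converges_to_def
  proof (intro allI, rule ccontr)
    fix u assume "\<not> (\<lambda>n. w n \<bullet> u) \<longlonglongrightarrow> l \<bullet> u"
    then obtain d and r :: "nat \<Rightarrow> nat" where "d > 0" and r: "strict_mono r"
      and far: "\<And>n. d \<le> dist (w (r n) \<bullet> u) (l \<bullet> u)"
      using not_tendsto_subsequence by metis
    obtain q l' where q: "strict_mono q" and l': "weakly_converges_to (w \<circ> r \<circ> q) l'"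
      by (rule bounded_weakly_convergent_subsequence[of "w \<circ> r"]) (use bound in simp)
    have "l' = l" using unique[of "r \<circ> q"] r q l' by (simp add: strict_mono_o o_assoc)
    then have "(\<lambda>n. w (r (q n)) \<bullet> u) \<longlonglongrightarrow> l \<bullet> u"
      using l' by (simp add: weakly_converges_to_def)
    then have "\<forall>\<^sub>F n in sequentially. dist (w (r (q n)) \<bullet> u) (l \<bullet> u) < d"
      using \<open>d > 0\<close> by (rule tendstoD)
    then show False using far by (auto simp: eventually_sequentially not_less[symmetric])
  qed
  with \<open>l \<in> E\<close> show ?thesis by blast
qed

section \<open>The Douglas-Rachford iteration\<close>

text \<open>Monotonicity between two candidates \<open>a\<close> and \<open>b\<close> gives
  \<open>0 \<le> - (norm (b - a))\<^sup>2\<close>. This is the uniqueness half of single-valuedness;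
  \<open>minty\<close> is the existence half.\<close>

lemma resolvent_eqI:
  assumes "maximally_monotone A" and a: "x - a \<in> A a"
  shows "resolvent A x = a"
proof -
  have "b = a" if "x - b \<in> A b" for b
  proof -
    have "0 \<le> (b - a) \<bullet> ((x - b) - (x - a))"
      by (rule maximally_monotoneD[OF assms(1) that a])
    also have "(x - b) - (x - a) = - (b - a)" by simp
    finally have "(b - a) \<bullet> (b - a) \<le> 0" by (simp only: inner_minus_right neg_0_le_iff_le)
    then have "(b - a) \<bullet> (b - a) = 0" using inner_ge_zero by (rule antisym)
    then show ?thesis by simp
  qed
  moreover have "b \<in> op_inverse (op_plus op_id A) x \<longleftrightarrow> x - b \<in> A b" for b
    by (auto simp: op_inverse_def op_plus_def op_id_def set_plus_def intro: bexI[of _ "x - b"])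
  ultimately have "op_inverse (op_plus op_id A) x = {a}"
    using a by blast
  then show ?thesis by (simp add: resolvent_def)
qed

lemma resolvent_mem:
  fixes A :: "'a::{real_inner, complete_space} \<Rightarrow> 'a set"
  assumes "maximally_monotone A"
  shows "x - resolvent A x \<in> A (resolvent A x)"
  using minty[OF assms, of x] resolvent_eqI[OF assms] by metis

text \<open>Swapping the coordinates of a graph preserves both monotonicity and inclusion.\<close>

lemma maximally_monotone_op_inverse:
  fixes A :: "'a::real_inner \<Rightarrow> 'a set"
  assumes "maximally_monotone A"
  shows "maximally_monotone (op_inverse A)"
proof -
  have mono: "monotone_op (op_inverse C)" if "monotone_op C" for C :: "'a \<Rightarrow> 'a set"
    using that by (fastforce simp: monotone_op_def op_graph_def op_inverse_def inner_commute)
  have "op_graph B = op_graph (op_inverse A)"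
    if B: "monotone_op B" "op_graph (op_inverse A) \<subseteq> op_graph B" for B
  proof -
    have "op_graph A \<subseteq> op_graph (op_inverse B)"
      using B(2) by (auto simp: op_graph_def op_inverse_def)
    then have "op_graph (op_inverse B) = op_graph A"
      using assms mono[OF B(1)] by (simp add: maximally_monotone_def)
    then show ?thesis by (auto simp: op_graph_def op_inverse_def set_eq_iff)
  qed
  then show ?thesis
    using assms mono by (simp add: maximally_monotone_def)
qed

text \<open>With \<open>a = resolvent A x\<close>, the relation \<open>x - a \<in> A a\<close> also
  says that \<open>x - a\<close> solves the resolvent inclusion of the inverse at
  \<open>x\<close>.\<close>

lemma resolvent_op_inverse:
  fixes A :: "'a::{real_inner, complete_space} \<Rightarrow> 'a set"
  assumes "maximally_monotone A"
  shows "resolvent (op_inverse A) x = x - resolvent A x"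
  by (rule resolvent_eqI[OF maximally_monotone_op_inverse[OF assms]])
    (use resolvent_mem[OF assms, of x] in \<open>simp add: op_inverse_def\<close>)

lemma norm_Pair_diff_power2:
  "(norm ((a, b) - (c, d)))\<^sup>2 = (norm (a - c))\<^sup>2 + (norm (b - d))\<^sup>2"
  by (simp add: norm_Pair)

text \<open>For maximally monotone \<open>A\<close> this is Minty's parametrization of the graph of
  \<open>A\<close>, \<open>x\<close> being the sum of the two components.\<close>

definition primal_dual_resolvent :: "('a::real_inner \<Rightarrow> 'a set) \<Rightarrow> 'a \<Rightarrow> 'a \<times> 'a" where
  "primal_dual_resolvent A x = (resolvent A x, resolvent (op_inverse A) x)"

lemma douglas_rachford_decrease:
  fixes A B :: "'a::{real_inner, complete_space} \<Rightarrow> 'a set"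
  assumes A: "maximally_monotone A" and B: "maximally_monotone B"
    and s: "s \<in> extended_solutions A B"
  defines "T \<equiv> douglas_rachford A B"
  shows "(norm (primal_dual_resolvent A (T x) - s))\<^sup>2
    \<le> (norm (primal_dual_resolvent A x - s))\<^sup>2 - (norm (x - T x))\<^sup>2"
proof -
  obtain z k where zk: "s = (z, k)" "k \<in> A z" "- k \<in> B z"
    using s by (auto simp: extended_solutions_def)
  define a where "a = resolvent A x"
  define u where "u = x - a"
  define b where "b = resolvent B (a - u)"
  have Tx: "T x = u + b"
    by (simp add: T_def douglas_rachford_def reflected_resolvent_def u_def b_def a_def scaleR_2 algebra_simps)
  define a' where "a' = resolvent A (T x)"
  define u' where "u' = T x - a'"
  have "u' \<in> A a'" unfolding u'_def a'_def by (rule resolvent_mem[OF A])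
  from maximally_monotoneD[OF A this zk(2)] have 1: "0 \<le> (a' - z) \<bullet> (u' - k)" .
  have "a - u - b \<in> B b" unfolding b_def by (rule resolvent_mem[OF B])
  from maximally_monotoneD[OF B this zk(3)]
  have "0 \<le> (b - z) \<bullet> (a - u - b - - k)" .
  also have "a - u - b - - k = (a - z) - (b - z) - (u - k)" by simp
  finally have 2: "0 \<le> (b - z) \<bullet> ((a - z) - (b - z) - (u - k))" .
  \<comment> \<open>Used with \<alpha> = \<open>a - z\<close>, \<beta> = \<open>b - z\<close> and
    \<gamma> = \<open>u - k\<close>: the inner product is the monotonicity term of \<open>B\<close>,
    and the subtracted square is the decrease \<open>(norm (x - T x))\<^sup>2\<close>.\<close>
  have parallelogram: "(norm (\<beta> + \<gamma>))\<^sup>2 + 2 * (\<beta> \<bullet> (\<alpha> - \<beta> - \<gamma>))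
      = (norm \<alpha>)\<^sup>2 + (norm \<gamma>)\<^sup>2 - (norm (\<alpha> - \<beta>))\<^sup>2" for \<alpha> \<beta> \<gamma> :: 'a
    by (simp add: power2_norm_eq_inner inner_simps inner_commute)
  have square_sum: "(norm (\<alpha> + \<beta>))\<^sup>2 = (norm \<alpha>)\<^sup>2 + (norm \<beta>)\<^sup>2 + 2 * (\<alpha> \<bullet> \<beta>)" for \<alpha> \<beta> :: 'a
    by (simp add: power2_norm_eq_inner inner_simps inner_commute)
  have "(norm (a' - z))\<^sup>2 + (norm (u' - k))\<^sup>2
      = (norm ((a' - z) + (u' - k)))\<^sup>2 - 2 * ((a' - z) \<bullet> (u' - k))"
    using square_sum[of "a' - z" "u' - k"] by linarith
  also have "\<dots> \<le> (norm ((a' - z) + (u' - k)))\<^sup>2" using 1 by simp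
  \<comment> \<open>This links the two iterates: both sides are \<open>T x - z - k\<close>.\<close>
  also have "(a' - z) + (u' - k) = (b - z) + (u - k)"
    by (simp add: u'_def Tx)
  also have "(norm ((b - z) + (u - k)))\<^sup>2
      \<le> (norm ((b - z) + (u - k)))\<^sup>2 + 2 * ((b - z) \<bullet> ((a - z) - (b - z) - (u - k)))"
    using 2 by simp
  also have "\<dots> = (norm (a - z))\<^sup>2 + (norm (u - k))\<^sup>2 - (norm ((a - z) - (b - z)))\<^sup>2"
    by (rule parallelogram)
  also have "(a - z) - (b - z) = x - T x"
    by (simp add: Tx u_def)
  finally show ?thesis
    by (simp add: zk primal_dual_resolvent_def resolvent_op_inverse[OF A] norm_Pair_diff_power2
        a_def[symmetric] u_def[symmetric] a'_def[symmetric] u'_def[symmetric] del: diff_Pair)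
qed

text \<open>Weak convergence does not control products of two varying sequences; here strong
  convergence of one factor to 0 does.\<close>

lemma inner_tendsto_0:
  fixes f g :: "nat \<Rightarrow> 'a::real_inner"
  assumes "f \<longlonglongrightarrow> 0" and "\<And>n. norm (g n) \<le> K"
  shows "(\<lambda>n. f n \<bullet> g n) \<longlonglongrightarrow> 0"
proof (rule Lim_null_comparison[OF always_eventually])
  show "\<forall>n. norm (f n \<bullet> g n) \<le> K * norm (f n)"
  proof
    fix n
    have "norm (f n \<bullet> g n) \<le> norm (f n) * norm (g n)" using Cauchy_Schwarz_ineq2 by simp
    also have "\<dots> \<le> norm (f n) * K" using assms(2) by (intro mult_left_mono) auto
    finally show "norm (f n \<bullet> g n) \<le> K * norm (f n)" by (simp add: mult.commute)
  qed
  show "(\<lambda>n. K * norm (f n)) \<longlonglongrightarrow> 0"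
    using tendsto_mult_right_zero[OF tendsto_norm_zero[OF assms(1)]] by simp
qed

text \<open>Testing the limiting inequality with \<open>y = J\<^sub>A (p + q)\<close> and \<open>y' = J\<^sub>B (p - q)\<close> makes both
  summands nonpositive, namely \<open>- (norm (p - y))\<^sup>2\<close> and \<open>- (norm (p - y'))\<^sup>2\<close>.\<close>

lemma extended_solutions_weak_limit:
  fixes A B :: "'a::{real_inner, complete_space} \<Rightarrow> 'a set"
  assumes A: "maximally_monotone A" and B: "maximally_monotone B"
    and u: "\<And>n. u n \<in> A (a n)" and v: "\<And>n. v n \<in> B (b n)"
    and ab: "(\<lambda>n. a n - b n) \<longlonglongrightarrow> 0" and uv: "(\<lambda>n. u n + v n) \<longlonglongrightarrow> 0"
    and bound_u: "\<And>n. norm (u n) \<le> K" and bound_a: "\<And>n. norm (a n) \<le> K"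
    and lim_a: "weakly_converges_to a p" and lim_u: "weakly_converges_to u q"
  shows "(p, q) \<in> extended_solutions A B"
proof -
  have a: "(\<lambda>n. a n \<bullet> y) \<longlonglongrightarrow> p \<bullet> y" and u': "(\<lambda>n. u n \<bullet> y) \<longlonglongrightarrow> q \<bullet> y" for y
    using lim_a lim_u by (auto simp: weakly_converges_to_def)
  have ab0: "(\<lambda>n. (a n - b n) \<bullet> y) \<longlonglongrightarrow> 0" and uv0: "(\<lambda>n. (u n + v n) \<bullet> y) \<longlonglongrightarrow> 0" for y
    using inner_tendsto_0[OF ab, of "\<lambda>_. y" "norm y"] inner_tendsto_0[OF uv, of "\<lambda>_. y" "norm y"] by auto
  have abu: "(\<lambda>n. (a n - b n) \<bullet> u n) \<longlonglongrightarrow> 0" by (rule inner_tendsto_0[OF ab bound_u])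
  have uva: "(\<lambda>n. (u n + v n) \<bullet> a n) \<longlonglongrightarrow> 0" by (rule inner_tendsto_0[OF uv bound_a])
  have uvab: "(\<lambda>n. (u n + v n) \<bullet> (a n - b n)) \<longlonglongrightarrow> 0"
    using tendsto_inner[OF uv ab] by simp
  have ineq: "0 \<le> (p - y) \<bullet> (q - w) + (p - y') \<bullet> (- q - w')"
    if w: "w \<in> A y" and w': "w' \<in> B y'" for y w y' w'
  proof (rule LIMSEQ_le_const)
    \<comment> \<open>Writing \<open>b n\<close> as \<open>a n - (a n - b n)\<close> and
      \<open>v n\<close> as \<open>(u n + v n) - u n\<close> cancels
      \<open>a n \<bullet> u n\<close>, the one product without a limit at hand. Each remaining
      product of two sequences has a factor tending strongly to 0, and the other terms are constant
      or linear in a single sequence.\<close>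
    let ?f = "\<lambda>n. (a n - b n) \<bullet> u n + (u n + v n) \<bullet> a n - (u n + v n) \<bullet> (a n - b n)
      - a n \<bullet> w - u n \<bullet> y + y \<bullet> w
      - (a n \<bullet> w' - (a n - b n) \<bullet> w') - ((u n + v n) \<bullet> y' - u n \<bullet> y') + y' \<bullet> w'"
    have "?f \<longlonglongrightarrow> 0 + 0 - 0 - p \<bullet> w - q \<bullet> y + y \<bullet> w - (p \<bullet> w' - 0) - (0 - q \<bullet> y') + y' \<bullet> w'"
      by (intro tendsto_add tendsto_diff tendsto_const abu uva uvab a u' ab0 uv0)
    moreover have "0 + 0 - 0 - p \<bullet> w - q \<bullet> y + y \<bullet> w - (p \<bullet> w' - 0) - (0 - q \<bullet> y') + y' \<bullet> w'
      = (p - y) \<bullet> (q - w) + (p - y') \<bullet> (- q - w')"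
      by (simp add: inner_diff_left inner_diff_right inner_commute)
    moreover have "?f = (\<lambda>n. (a n - y) \<bullet> (u n - w) + (b n - y') \<bullet> (v n - w'))"
      by (simp add: fun_eq_iff inner_diff_left inner_diff_right inner_add_left inner_add_right inner_commute)
    ultimately show "(\<lambda>n. (a n - y) \<bullet> (u n - w) + (b n - y') \<bullet> (v n - w'))
        \<longlonglongrightarrow> (p - y) \<bullet> (q - w) + (p - y') \<bullet> (- q - w')"
      by simp
    show "\<exists>N. \<forall>n\<ge>N. 0 \<le> (a n - y) \<bullet> (u n - w) + (b n - y') \<bullet> (v n - w')"
      using maximally_monotoneD[OF A u w] maximally_monotoneD[OF B v w'] by (auto intro: add_nonneg_nonneg)
  qed
  define y where "y = resolvent A (p + q)"
  define y' where "y' = resolvent B (p - q)"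
  have w: "p + q - y \<in> A y" and w': "p - q - y' \<in> B y'"
    unfolding y_def y'_def using resolvent_mem A B by blast+
  have "0 \<le> (p - y) \<bullet> (- (p - y)) + (p - y') \<bullet> (- (p - y'))"
    using ineq[OF w w'] by (simp add: algebra_simps)
  then have "(p - y) \<bullet> (p - y) + (p - y') \<bullet> (p - y') \<le> 0"
    by (simp only: inner_minus_right)
  then have "(p - y) \<bullet> (p - y) + (p - y') \<bullet> (p - y') = 0"
    by (intro antisym add_nonneg_nonneg inner_ge_zero)
  then have "p - y = 0 \<and> p - y' = 0"
    by (simp only: add_nonneg_eq_0_iff[OF inner_ge_zero inner_ge_zero] inner_eq_zero_iff)
  then have "y = p" "y' = p" by auto
  with w w' show ?thesis by (simp add: extended_solutions_def)
qed

theorem theorem6p2: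
  fixes A B :: "'a::{real_inner, complete_space} \<Rightarrow> 'a set"
    and T :: "'a \<Rightarrow> 'a"
    and x z k :: 'a
  assumes "maximally_monotone A"
    and "maximally_monotone B"
    and "primal_solutions A B \<noteq> {}"
    and "T = douglas_rachford A B"
    and "fix_points T \<noteq> {}"
    and "(z, k) \<in> extended_solutions A B"
  shows
    "(\<forall>n.
        (norm ((resolvent A ((T ^^ (n + 1)) x), resolvent (op_inverse A) ((T ^^ (n + 1)) x)) - (z, k)))\<^sup>2
          = (norm (resolvent A ((T ^^ (n + 1)) x) - z))\<^sup>2
            + (norm (resolvent (op_inverse A) ((T ^^ (n + 1)) x) - k))\<^sup>2
      \<and> (norm (resolvent A ((T ^^ (n + 1)) x) - z))\<^sup>2
            + (norm (resolvent (op_inverse A) ((T ^^ (n + 1)) x) - k))\<^sup>2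
          \<le> (norm (resolvent A ((T ^^ n) x) - z))\<^sup>2
            + (norm (resolvent (op_inverse A) ((T ^^ n) x) - k))\<^sup>2
      \<and> (norm (resolvent A ((T ^^ n) x) - z))\<^sup>2
            + (norm (resolvent (op_inverse A) ((T ^^ n) x) - k))\<^sup>2
          = (norm ((resolvent A ((T ^^ n) x), resolvent (op_inverse A) ((T ^^ n) x)) - (z, k)))\<^sup>2)
   \<and> fejer_monotone (\<lambda>n. (resolvent A ((T ^^ n) x), resolvent (op_inverse A) ((T ^^ n) x)))
        (extended_solutions A B)
   \<and> (\<exists>s \<in> extended_solutions A B.
        weakly_converges_to
          (\<lambda>n. (resolvent A ((T ^^ n) x), resolvent (op_inverse A) ((T ^^ n) x))) s)"
proof -
  note A = assms(1) and B = assms(2)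
  let ?S = "extended_solutions A B"
  define c where "c n = primal_dual_resolvent A ((T ^^ n) x)" for n
  have c: "c n = (resolvent A ((T ^^ n) x), resolvent (op_inverse A) ((T ^^ n) x))" for n
    by (simp add: c_def primal_dual_resolvent_def)
  define g where "g n = (T ^^ n) x - T ((T ^^ n) x)" for n
  have dec: "(norm (c (Suc n) - s))\<^sup>2 \<le> (norm (c n - s))\<^sup>2 - (norm (g n))\<^sup>2" if "s \<in> ?S" for n s
    using douglas_rachford_decrease[OF A B that] by (simp add: c_def g_def assms(4))
  have fejer: "fejer_monotone c ?S"
    unfolding fejer_monotone_def
  proof (intro ballI allI)
    fix s n assume "s \<in> ?S"
    from dec[OF this, of n] have "(norm (c (Suc n) - s))\<^sup>2 \<le> (norm (c n - s))\<^sup>2"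
      using zero_le_power2[of "norm (g n)"] by linarith
    then show "norm (c (Suc n) - s) \<le> norm (c n - s)" by (rule power2_le_imp_le) simp
  qed
  \<comment> \<open>The decreases telescope against the squared distance to \<open>(z, k)\<close>,
    so the squared residuals are summable and \<open>g\<close> tends to 0.\<close>
  have "summable (\<lambda>n. (norm (g n))\<^sup>2)"
  proof (rule summableI_nonneg_bounded)
    fix n
    have "(\<Sum>i<n. (norm (g i))\<^sup>2) \<le> (norm (c 0 - (z, k)))\<^sup>2 - (norm (c n - (z, k)))\<^sup>2"
    proof (induction n)
      case (Suc n)
      then show ?case using dec[OF assms(6), of n] by simp
    qed simp
    also have "\<dots> \<le> (norm (c 0 - (z, k)))\<^sup>2" by simp
    finally show "(\<Sum>i<n. (norm (g i))\<^sup>2) \<le> (norm (c 0 - (z, k)))\<^sup>2" .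
  qed simp
  then have "(\<lambda>n. sqrt ((norm (g n))\<^sup>2)) \<longlonglongrightarrow> sqrt 0"
    by (intro tendsto_real_sqrt summable_LIMSEQ_zero)
  then have g0: "g \<longlonglongrightarrow> 0" by (simp add: tendsto_norm_zero_iff)
  have bound: "norm (c n) \<le> norm (c 0 - (z, k)) + norm (z, k)" for n
  proof -
    have "norm (c n - (z, k)) \<le> norm (c 0 - (z, k))"
      using fejer assms(6) by (induction n) (auto simp: fejer_monotone_def intro: order_trans)
    then show ?thesis using norm_triangle_ineq[of "c n - (z, k)" "(z, k)"] by simp
  qed
  have weak: "\<exists>s\<in>?S. weakly_converges_to c s"
  proof (rule fejer_monotone_weak_convergence[OF fejer])
    show "?S \<noteq> {}" using assms(6) by blast
    fix r l assume r: "strict_mono r" and l: "weakly_converges_to (c \<circ> r) l"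
    obtain p q where pq: "l = (p, q)" by fastforce
    define xs where "xs n = (T ^^ r n) x" for n
    define a where "a n = resolvent A (xs n)" for n
    define u where "u n = xs n - a n" for n
    define b where "b n = resolvent B (a n - u n)" for n
    define v where "v n = a n - u n - b n" for n
    have cr: "c (r n) = (a n, u n)" for n
      by (simp add: c a_def u_def xs_def resolvent_op_inverse[OF A])
    have gr: "g (r n) = a n - b n" for n
    proof -
      have "T (xs n) = xs n - a n + b n"
        by (simp add: assms(4) douglas_rachford_def reflected_resolvent_def
            b_def u_def a_def scaleR_2 algebra_simps)
      then show ?thesis by (simp add: g_def xs_def)
    qed
    have ab: "(\<lambda>n. a n - b n) \<longlonglongrightarrow> 0"
      using LIMSEQ_subseq_LIMSEQ[OF g0 r] by (simp add: o_def gr)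
    have "(p, q) \<in> ?S"
    proof (rule extended_solutions_weak_limit[OF A B _ _ ab])
      show "u n \<in> A (a n)" for n unfolding u_def a_def by (rule resolvent_mem[OF A])
      show "v n \<in> B (b n)" for n unfolding v_def b_def by (rule resolvent_mem[OF B])
      show "(\<lambda>n. u n + v n) \<longlonglongrightarrow> 0" using ab by (simp add: v_def algebra_simps)
      show "norm (u n) \<le> norm (c 0 - (z, k)) + norm (z, k)" for n
        using bound[of "r n"] norm_snd_le[of "u n" "a n"] by (simp add: cr)
      show "norm (a n) \<le> norm (c 0 - (z, k)) + norm (z, k)" for n
        using bound[of "r n"] norm_fst_le[of "a n" "u n"] by (simp add: cr)
      \<comment> \<open>Weak convergence in the product space, tested against \<open>(d, 0)\<close>
        and \<open>(0, e)\<close>, gives it in each component.\<close>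
      have "(\<lambda>n. a n \<bullet> d + u n \<bullet> e) \<longlonglongrightarrow> p \<bullet> d + q \<bullet> e" for d e
        using l by (simp add: weakly_converges_to_def cr pq)
      from this[of _ 0] this[of 0]
      show "weakly_converges_to a p" "weakly_converges_to u q"
        by (simp_all add: weakly_converges_to_def)
    qed
    then show "l \<in> ?S" by (simp add: pq)
  qed
  have step: "(norm (c (n + 1) - (z, k)))\<^sup>2 \<le> (norm (c n - (z, k)))\<^sup>2" for n
    using fejer assms(6) by (auto simp: fejer_monotone_def intro!: power_mono)
  have square: "(norm (c n - (z, k)))\<^sup>2
      = (norm (resolvent A ((T ^^ n) x) - z))\<^sup>2 + (norm (resolvent (op_inverse A) ((T ^^ n) x) - k))\<^sup>2" for n
    by (simp add: c norm_Pair_diff_power2 del: diff_Pair)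
  have c_fun: "c = (\<lambda>n. (resolvent A ((T ^^ n) x), resolvent (op_inverse A) ((T ^^ n) x)))"
    by (rule ext) (rule c)
  show ?thesis
    using step[unfolded square] fejer[unfolded c_fun] weak[unfolded c_fun]
    unfolding norm_Pair_diff_power2 by simp
qed

end
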